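(* Let $U=U_1\times\cdots\times U_m$ be a Cartesian product of nonempty finite sets. For a set $S\subseteq U$, the following conditions are equivalent: (1) $S$ is ample, i.e. $S$ is $\mathrm{MProd}(U)$-ample; (2) $S$ is $\mathrm{MProd}^*(U)$-ample; (3) $S$ is $\mathrm{MProd}^{**}(U)$-ample; (4) $S$ is $\mathrm{M_{ext}Prod}(U)$-ample. Moreover, a set $S\subseteq U$ is lopsided if and only if $S$ is weakly ample, and every ample set $S\subseteq U$ is lopsided.
   Context: Let $X=\{1,\dots,m\}$. A subproduct of $U$ with support $A=\{i_1,\dots,i_k\}\subseteq X$ is a product $V=V_{i_1}\times\cdots\times V_{i_k}$ with $\varnothing\neq V_{i_j}\subseteq U_{i_j}$; it is full-dimensional if $A=X$. A generalized partition of a subproduct $V=\prod_{i\in A}V_i$ is a tuple $\Lambda=(\alpha_i)_{i\in A}$ where $\alpha_i$ is a partition of $V_i$ into nonempty blocks. It defines the partition of $V$ into the boxes $\prod_{i\in A}P^i$ with $P^i\in\alpha_i$, and the minor-subproduct $M(\Lambda,V)=\prod_{i\in A} M_i$, where $M_i$ is the set of blocks of $\alpha_i$ (so elements of $M(\Lambda,V)$ correspond bijectively to boxes). A partition $\alpha_i$ is trivial if all its blocks are singletons, co-trivial if it has exactly one block, quasi-trivial if at most one of its blocks is not a singleton. Shattering. If $V$ is full-dimensional, $M(\Lambda,V)$ is shattered by $S\subseteq U$ if $S$ meets every box of the box-partition of $V$ defined by $\Lambda$. A copy of $M(\Lambda,V)$ is a set $W=W_1\times\cdots\times W_m$ where each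 $W_i$ consists of exactly one element chosen from each block of $\alpha_i$. $M(\Lambda,V)$ is strongly shattered by $S$ if $S$ contains a copy of it. If $V$ has support $A\neq X$, put $V'_i=V_i,\ \alpha'_i=\alpha_i$ for $i\in A$ and $V'_i=U_i,\ \alpha_i'=\{U_i\}$ for $i\notin A$; then $M(\Lambda,V)$ is (strongly) shattered by $S$ if $M(\Lambda',V')$ is (strongly) shattered by $S$, where $\Lambda'=(\alpha'_1,\dots,\alpha'_m)$ and $V'=V_1'\times\cdots\times V_m'$. $\mathrm{MProd}(U)$ is the set of all minor-subproducts of $U$ (the case $V=U$); $\mathrm{MProd}^*(U)$ is the set of all minor-subproducts of all full-dimensional subproducts $V$ of $U$; $\mathrm{MProd}^{**}(U)$ is the set of all minor-subproducts of all subproducts $V$ of $U$; $\mathrm{M_{ext}Prod}(U)$ is the set of those $M(\Lambda,U)\in\mathrm{MProd}(U)$ for which all $\alpha_i$ are quasi-trivial; a minor-subproduct $M(\Lambda,U)$ is mixed if each $\alpha_i$ is trivial or co-trivial. For a set $\mathcal M$ of minor-subproducts, $S$ is $\mathcal M$-ample if each $M\in\mathcal M$ shattered by $S$ is strongly shattered by $S$. $S$ is weakly ample if it is $\mathcal M$-ample for $\mathcal M$ the set of all mixed minor-subproducts of $U$. The complement $M^\diamond$ of a mixed minor-subproduct $M$ is the mixed minor-subproduct obtained by replacing each trivial partition by the co-trivial partition and vice versa. With $S^*=U\setminus S$, the set $S$ is lopsided if for every mixed minor-subproduct $M$ of $U$, either $M$ is strongly shattered by $S$ or $M^\diamond$ is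 strongly shattered by $S^*$. *)

theory Defs
  imports "HOL-Library.FuncSet" "HOL-Library.Disjoint_Sets"
begin

text \<open>
  The product of sets \<open>U 1, ..., U m\<close> is the set \<open>Pi\<^sub>E {1..m} U\<close> of extensional functions.
  All factors are subsets of one type, which is no restriction for a finite family of sets.
\<close>

definition is_subproduct ::
  "nat \<Rightarrow> (nat \<Rightarrow> 'a set) \<Rightarrow> nat set \<Rightarrow> (nat \<Rightarrow> 'a set) \<Rightarrow> bool" where
  "is_subproduct m U A V \<longleftrightarrow> A \<subseteq> {1..m} \<and> (\<forall>i\<in>A. V i \<noteq> {} \<and> V i \<subseteq> U i)"

definition is_generalized_partition ::
  "nat set \<Rightarrow> (nat \<Rightarrow> 'a set) \<Rightarrow> (nat \<Rightarrow> 'a set set) \<Rightarrow> bool" where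
  "is_generalized_partition A V \<Lambda> \<longleftrightarrow> (\<forall>i\<in>A. partition_on (V i) (\<Lambda> i))"

text \<open>
  A minor-subproduct is represented by its defining data \<open>(A, V, \<Lambda>)\<close>: support, factors of the
  subproduct, generalized partition. Only the values of \<open>V\<close> and \<open>\<Lambda>\<close> on \<open>A\<close> matter.
  The minor-subproduct as a set is \<open>minor_points\<close>; an element \<open>P\<close> of it is a choice of one
  block per coordinate and corresponds to the box \<open>Pi\<^sub>E A P\<close>.
\<close>

type_synonym 'a minor = "nat set \<times> (nat \<Rightarrow> 'a set) \<times> (nat \<Rightarrow> 'a set set)"

definition minor_points :: "'a minor \<Rightarrow> (nat \<Rightarrow> 'a set) set" where
  "minor_points = (\<lambda>(A, V, \<Lambda>). Pi\<^sub>E A \<Lambda>)"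

definition minor_boxes :: "'a minor \<Rightarrow> (nat \<Rightarrow> 'a) set set" where
  "minor_boxes = (\<lambda>(A, V, \<Lambda>). (\<lambda>P. Pi\<^sub>E A P) ` minor_points (A, V, \<Lambda>))"

definition trivial_partition :: "'a set set \<Rightarrow> bool" where
  "trivial_partition \<alpha> \<longleftrightarrow> (\<forall>B\<in>\<alpha>. is_singleton B)"

definition cotrivial_partition :: "'a set set \<Rightarrow> bool" where
  "cotrivial_partition \<alpha> \<longleftrightarrow> is_singleton \<alpha>"

definition quasitrivial_partition :: "'a set set \<Rightarrow> bool" where
  "quasitrivial_partition \<alpha> \<longleftrightarrow> (\<exists>\<^sub>\<le>\<^sub>1 B. B \<in> \<alpha> \<and> \<not> is_singleton B)"

definition MProd2 :: "nat \<Rightarrow> (nat \<Rightarrow> 'a set) \<Rightarrow> 'a minor set"  \<comment> \<open>\<open>MProd\<^sup>*\<^sup>*(U)\<close>\<close> where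
  "MProd2 m U = {(A, V, \<Lambda>). is_subproduct m U A V \<and> is_generalized_partition A V \<Lambda>}"

definition MProd1 :: "nat \<Rightarrow> (nat \<Rightarrow> 'a set) \<Rightarrow> 'a minor set"  \<comment> \<open>\<open>MProd\<^sup>*(U)\<close>\<close> where
  "MProd1 m U = {({1..m}, V, \<Lambda>) | V \<Lambda>.
     is_subproduct m U {1..m} V \<and> is_generalized_partition {1..m} V \<Lambda>}"

definition MProd :: "nat \<Rightarrow> (nat \<Rightarrow> 'a set) \<Rightarrow> 'a minor set" where
  "MProd m U = {({1..m}, U, \<Lambda>) | \<Lambda>. is_generalized_partition {1..m} U \<Lambda>}"

definition MextProd :: "nat \<Rightarrow> (nat \<Rightarrow> 'a set) \<Rightarrow> 'a minor set" where
  "MextProd m U = {(A, V, \<Lambda>) \<in> MProd m U. \<forall>i\<in>{1..m}. quasitrivial_partition (\<Lambda> i)}"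

definition MixedProd :: "nat \<Rightarrow> (nat \<Rightarrow> 'a set) \<Rightarrow> 'a minor set" where
  "MixedProd m U = {(A, V, \<Lambda>) \<in> MProd m U.
     \<forall>i\<in>{1..m}. trivial_partition (\<Lambda> i) \<or> cotrivial_partition (\<Lambda> i)}"

text \<open>The full-dimensional minor-subproduct \<open>M(\<Lambda>', V')\<close> associated with \<open>M(\<Lambda>, V)\<close>.\<close>

definition full_minor :: "nat \<Rightarrow> (nat \<Rightarrow> 'a set) \<Rightarrow> 'a minor \<Rightarrow> 'a minor" where
  "full_minor m U = (\<lambda>(A, V, \<Lambda>).
     ({1..m}, (\<lambda>i. if i \<in> A then V i else U i), (\<lambda>i. if i \<in> A then \<Lambda> i else {U i})))"

definition is_copy :: "'a minor \<Rightarrow> (nat \<Rightarrow> 'a) set \<Rightarrow> bool" where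
  "is_copy = (\<lambda>(A, V, \<Lambda>) W. \<exists>w. W = Pi\<^sub>E A w \<and>
     (\<forall>i\<in>A. w i \<subseteq> V i \<and> (\<forall>B\<in>\<Lambda> i. \<exists>!x. x \<in> B \<and> x \<in> w i)))"

text \<open>
  On the index set \<open>{1..m}\<close>, \<open>full_minor\<close> leaves minor-subproducts of full support unchanged,
  so the following two definitions cover full and proper supports uniformly.
\<close>

definition shattered :: "nat \<Rightarrow> (nat \<Rightarrow> 'a set) \<Rightarrow> (nat \<Rightarrow> 'a) set \<Rightarrow> 'a minor \<Rightarrow> bool" where
  "shattered m U S M \<longleftrightarrow> (\<forall>B\<in>minor_boxes (full_minor m U M). S \<inter> B \<noteq> {})"

definition strongly_shattered ::
  "nat \<Rightarrow> (nat \<Rightarrow> 'a set) \<Rightarrow> (nat \<Rightarrow> 'a) set \<Rightarrow> 'a minor \<Rightarrow> bool" where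
  "strongly_shattered m U S M \<longleftrightarrow> (\<exists>W. is_copy (full_minor m U M) W \<and> W \<subseteq> S)"

definition ample_for ::
  "nat \<Rightarrow> (nat \<Rightarrow> 'a set) \<Rightarrow> 'a minor set \<Rightarrow> (nat \<Rightarrow> 'a) set \<Rightarrow> bool" where
  "ample_for m U \<M> S \<longleftrightarrow> (\<forall>M\<in>\<M>. shattered m U S M \<longrightarrow> strongly_shattered m U S M)"

definition ample :: "nat \<Rightarrow> (nat \<Rightarrow> 'a set) \<Rightarrow> (nat \<Rightarrow> 'a) set \<Rightarrow> bool" where
  "ample m U S \<longleftrightarrow> ample_for m U (MProd m U) S"

definition weakly_ample :: "nat \<Rightarrow> (nat \<Rightarrow> 'a set) \<Rightarrow> (nat \<Rightarrow> 'a) set \<Rightarrow> bool" where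
  "weakly_ample m U S \<longleftrightarrow> ample_for m U (MixedProd m U) S"

text \<open>
  Meant for mixed minor-subproducts of \<open>U\<close>, where a non-trivial partition is co-trivial.
  If \<open>U i\<close> is a singleton, its only partition is both trivial and co-trivial, and it is kept.
\<close>

definition minor_complement :: "'a minor \<Rightarrow> 'a minor" where
  "minor_complement = (\<lambda>(A, V, \<Lambda>).
     (A, V, \<lambda>i. if trivial_partition (\<Lambda> i) then {V i} else (\<lambda>x. {x}) ` V i))"

text \<open>
  The two alternatives exclude each other: a copy of a mixed \<open>M\<close> and a copy of its complement
  always intersect. Hence inclusive and exclusive disjunction agree here.
\<close>

definition lopsided :: "nat \<Rightarrow> (nat \<Rightarrow> 'a set) \<Rightarrow> (nat \<Rightarrow> 'a) set \<Rightarrow> bool" where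
  "lopsided m U S \<longleftrightarrow> (\<forall>M\<in>MixedProd m U. strongly_shattered m U S M \<or>
     strongly_shattered m U (Pi\<^sub>E {1..m} U - S) (minor_complement M))"

end

(* All nontrivial content is a one-coordinate exchange argument. Fix a coordinate i and the data
   N in the other coordinates, and call x good if the fibre of S over x shatters N. Suppose that S
   is ample whenever the i-th partition is quasi-trivial on U i, and let Q be the set of bad points.
   If S over Q shattered N, the partition into the good singletons and Q would produce a copy
   of N over a bad point q, making q good. Hence every set P over which S shatters N contains a good
   point. Merging Q with one good point x into a block, a copy must pick x from it, so a single
   copy of N lies over all good points simultaneously. Thus coordinates may be freed from
   quasi-triviality one at a time. Lopsidedness is weak ampleness because the copies of the
   complement of a mixed minor M are exactly the boxes of M. *)
theory Submission
  imports Defs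
begin

section \<open>Shattering for arbitrary families of sets\<close>

text \<open>The entries of \<open>\<Lambda>\<close> are arbitrary families of sets, so a single set
  \<open>B\<close> can be plugged in as \<open>\<Lambda>(i := {B})\<close>: this says that the part
  of \<open>S\<close> over \<open>B\<close> shatters the data in the other coordinates. Using
  \<open>Pi\<close> for the choices avoids bookkeeping outside \<open>I\<close>.\<close>

definition meets_boxes :: "'i set \<Rightarrow> ('i \<Rightarrow> 'a) set \<Rightarrow> ('i \<Rightarrow> 'a set set) \<Rightarrow> bool" where
  "meets_boxes I S \<Lambda> \<longleftrightarrow> (\<forall>P\<in>Pi I \<Lambda>. S \<inter> Pi\<^sub>E I P \<noteq> {})"

text \<open>
  For partitions this amounts to containing a copy: a set that meets every block can be shrunk to
  a transversal.
\<close>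

definition contains_transversal ::
  "'i set \<Rightarrow> ('i \<Rightarrow> 'a) set \<Rightarrow> ('i \<Rightarrow> 'a set set) \<Rightarrow> bool" where
  "contains_transversal I S \<Lambda> \<longleftrightarrow>
     (\<exists>L. (\<forall>i\<in>I. \<forall>B\<in>\<Lambda> i. L i \<inter> B \<noteq> {}) \<and> Pi\<^sub>E I L \<subseteq> S)"

text \<open>A box uses only one block in coordinate \<open>i\<close>. Shattering thus becomes a
  condition on each block of that coordinate separately, which is what makes the one-coordinate
  exchange possible.\<close>

lemma meets_boxes_upd_iff:
  assumes "i \<in> I"
  shows "meets_boxes I S (\<Lambda>(i := \<beta>)) \<longleftrightarrow> (\<forall>B\<in>\<beta>. meets_boxes I S (\<Lambda>(i := {B})))"
proof -
  have "Pi I (\<Lambda>(i := \<beta>)) = (\<Union>B\<in>\<beta>. Pi I (\<Lambda>(i := {B})))"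
  proof
    show "Pi I (\<Lambda>(i := \<beta>)) \<subseteq> (\<Union>B\<in>\<beta>. Pi I (\<Lambda>(i := {B})))"
    proof
      fix P assume P: "P \<in> Pi I (\<Lambda>(i := \<beta>))"
      then have "P i \<in> \<beta>"
        using Pi_mem[OF P assms] by simp
      moreover have "P \<in> Pi I (\<Lambda>(i := {P i}))"
        using P by (auto simp: Pi_iff split: if_splits)
      ultimately show "P \<in> (\<Union>B\<in>\<beta>. Pi I (\<Lambda>(i := {B})))"
        by blast
    qed
    show "(\<Union>B\<in>\<beta>. Pi I (\<Lambda>(i := {B}))) \<subseteq> Pi I (\<Lambda>(i := \<beta>))"
      by (intro UN_least Pi_mono) simp
  qed
  then show ?thesis
    by (simp add: meets_boxes_def ball_UN)
qed

lemma meets_boxes_upd_mono: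
  assumes meets: "meets_boxes I S (\<Lambda>(i := {B}))" and "B \<subseteq> C" "i \<in> I"
  shows "meets_boxes I S (\<Lambda>(i := {C}))"
  unfolding meets_boxes_def
proof
  fix P assume P: "P \<in> Pi I (\<Lambda>(i := {C}))"
  then have "P(i := B) \<in> Pi I (\<Lambda>(i := {B}))"
    by (auto simp: Pi_iff)
  then have "S \<inter> Pi\<^sub>E I (P(i := B)) \<noteq> {}"
    using meets unfolding meets_boxes_def by blast
  moreover have "Pi\<^sub>E I (P(i := B)) \<subseteq> Pi\<^sub>E I P"
    using P \<open>B \<subseteq> C\<close> \<open>i \<in> I\<close> by (intro PiE_mono) (auto simp: Pi_iff split: if_splits)
  ultimately show "S \<inter> Pi\<^sub>E I P \<noteq> {}"
    by blast
qed

lemma contains_transversal_imp_meets_boxes: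
  assumes "contains_transversal I S \<Lambda>"
  shows "meets_boxes I S \<Lambda>"
  unfolding meets_boxes_def
proof
  fix P assume P: "P \<in> Pi I \<Lambda>"
  obtain L where L: "\<forall>i\<in>I. \<forall>B\<in>\<Lambda> i. L i \<inter> B \<noteq> {}" "Pi\<^sub>E I L \<subseteq> S"
    using assms unfolding contains_transversal_def by blast
  have "\<forall>i\<in>I. \<exists>x. x \<in> L i \<inter> P i"
    using L(1) P by (fastforce simp: Pi_iff)
  then obtain f where "\<forall>i\<in>I. f i \<in> L i \<inter> P i"
    by metis
  then have "restrict f I \<in> Pi\<^sub>E I L \<inter> Pi\<^sub>E I P"
    by auto
  then show "S \<inter> Pi\<^sub>E I P \<noteq> {}"
    using L(2) by blast
qed

section \<open>From quasi-trivial partitions to arbitrary families\<close>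

lemma quasitrivial_partition_singletons_rest:
  assumes "T \<subset> U"
  shows "partition_on U (insert (U - T) ((\<lambda>x. {x}) ` T))"
    and "quasitrivial_partition (insert (U - T) ((\<lambda>x. {x}) ` T))"
  using assms
  by (auto simp: partition_on_def disjoint_def quasitrivial_partition_def Uniq_def)

text \<open>The exchange step in coordinate \<open>i\<close>. Here \<open>\<Lambda> i\<close> is
  just a nonempty family of nonempty subsets of \<open>U\<close>, so that partitions of proper
  subsets of \<open>U\<close> are covered, while \<open>quasi\<close> speaks only of partitions of
  all of \<open>U\<close>.\<close>

lemma transversal_of_quasitrivial:
  assumes i: "i \<in> I" and ne: "\<Lambda> i \<noteq> {}" and sub: "\<And>B. B \<in> \<Lambda> i \<Longrightarrow> B \<noteq> {} \<and> B \<subseteq> U"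
    and meets: "meets_boxes I S \<Lambda>" and "U \<noteq> {}"
    and quasi: "\<And>\<beta>. partition_on U \<beta> \<Longrightarrow> quasitrivial_partition \<beta> \<Longrightarrow>
      meets_boxes I S (\<Lambda>(i := \<beta>)) \<Longrightarrow> contains_transversal I S (\<Lambda>(i := \<beta>))"
  shows "contains_transversal I S \<Lambda>"
proof -
  let ?sh = "\<lambda>B. meets_boxes I S (\<Lambda>(i := {B}))"
  define T where "T = {x\<in>U. ?sh {x}}"
  define Q where "Q = U - T"
  have blocks: "?sh B" if "B \<in> \<Lambda> i" for B
    using meets meets_boxes_upd_iff[OF i, of S \<Lambda> "\<Lambda> i"] that by simp
  have mono: "?sh C" if "?sh B" "B \<subseteq> C" for B C
    using meets_boxes_upd_mono[OF that i] .
  \<comment> \<open>Applied twice below: with \<open>T' = T\<close> to refute that \<open>S\<close>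
    shatters over the bad points, and with \<open>T' = T - {x0}\<close> to build the final
    transversal.\<close>
  have transversal: "\<exists>L. (\<forall>j\<in>I-{i}. \<forall>B\<in>\<Lambda> j. L j \<inter> B \<noteq> {}) \<and> Pi\<^sub>E I L \<subseteq> S \<and>
      T' \<subseteq> L i \<and> L i \<inter> (U - T') \<noteq> {} \<and> (\<forall>x \<in> L i. ?sh {x})"
    if T': "T' \<subseteq> T" "T' \<subset> U" "?sh (U - T')" for T'
  proof -
    let ?\<beta> = "insert (U - T') ((\<lambda>x. {x}) ` T')"
    have "meets_boxes I S (\<Lambda>(i := ?\<beta>))"
      unfolding meets_boxes_upd_iff[OF i, of S \<Lambda> ?\<beta>] using T' by (auto simp: T_def)
    then have "contains_transversal I S (\<Lambda>(i := ?\<beta>))"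
      using quasi quasitrivial_partition_singletons_rest[OF T'(2)] by blast
    then obtain L where L: "\<forall>j\<in>I. \<forall>B\<in>(\<Lambda>(i := ?\<beta>)) j. L j \<inter> B \<noteq> {}" "Pi\<^sub>E I L \<subseteq> S"
      unfolding contains_transversal_def by blast
    have others: "\<forall>j\<in>I-{i}. \<forall>B\<in>\<Lambda> j. L j \<inter> B \<noteq> {}"
      using L(1) by auto
    \<comment> \<open>The same \<open>L\<close> is a transversal when coordinate \<open>i\<close>
      carries only the block \<open>{x}\<close>, so every point of \<open>L i\<close> is
      good.\<close>
    have "?sh {x}" if "x \<in> L i" for x
    proof (rule contains_transversal_imp_meets_boxes)
      show "contains_transversal I S (\<Lambda>(i := {{x}}))"
        unfolding contains_transversal_def using others L(2) that by (intro exI[of _ L]) auto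
    qed
    moreover have "T' \<subseteq> L i" "L i \<inter> (U - T') \<noteq> {}"
      using L(1) i by (auto dest!: bspec[of _ _ i])
    ultimately show ?thesis
      using others L(2) by blast
  qed
  have bad: "\<not> ?sh Q" if "Q \<noteq> {}"
  proof
    assume "?sh Q"
    then have "?sh (U - T)" "T \<subset> U"
      using that by (auto simp: Q_def T_def)
    then obtain L where "L i \<inter> (U - T) \<noteq> {}" "\<forall>x\<in>L i. ?sh {x}"
      using transversal[of T] by blast
    then show False
      by (auto simp: T_def)
  qed
  have good: "B \<inter> T \<noteq> {}" if "B \<subseteq> U" "?sh B" "B \<noteq> {}" for B
  proof
    assume "B \<inter> T = {}"
    then have "B \<subseteq> Q"
      using that by (auto simp: Q_def)
    then show False
      using bad mono[OF \<open>?sh B\<close>] that by auto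
  qed
  obtain B0 where "B0 \<in> \<Lambda> i"
    using ne by blast
  \<comment> \<open>Some block lies in \<open>U\<close>, so by monotonicity \<open>U\<close> itself
    qualifies and must contain a good point.\<close>
  then have "?sh U"
    using blocks mono sub by blast
  then obtain x0 where x0: "x0 \<in> T"
    using good[of U] \<open>U \<noteq> {}\<close> by blast
  \<comment> \<open>The block left over is \<open>Q\<close> together with \<open>x0\<close>; it
    qualifies because it contains the good point \<open>x0\<close>.\<close>
  then have "?sh (U - (T - {x0}))" "T - {x0} \<subset> U"
    using mono[of "{x0}" "U - (T - {x0})"] by (auto simp: T_def)
  then obtain L where L: "\<forall>j\<in>I-{i}. \<forall>B\<in>\<Lambda> j. L j \<inter> B \<noteq> {}" "Pi\<^sub>E I L \<subseteq> S" "T - {x0} \<subseteq> L i"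
    "L i \<inter> (U - (T - {x0})) \<noteq> {}" "\<forall>x \<in> L i. ?sh {x}"
    using transversal[of "T - {x0}"] by blast
  \<comment> \<open>\<open>L i\<close> meets the leftover block in a good point, and the only good
    point there is \<open>x0\<close>.\<close>
  have "T \<subseteq> L i"
    using L(3-5) by (auto simp: T_def)
  moreover have "B \<inter> T \<noteq> {}" if "B \<in> \<Lambda> i" for B
    using good sub blocks that by blast
  ultimately have "\<forall>j\<in>I. \<forall>B\<in>\<Lambda> j. L j \<inter> B \<noteq> {}"
    using L(1) by blast
  then show ?thesis
    unfolding contains_transversal_def using L(2) by (intro exI[of _ L] conjI)
qed

lemma contains_transversal_if_quasitrivial:
  assumes "finite I" and U: "\<And>i. i \<in> I \<Longrightarrow> U i \<noteq> {}"
    and quasi: "\<And>\<Lambda>. \<lbrakk>\<And>i. i \<in> I \<Longrightarrow> partition_on (U i) (\<Lambda> i);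
      \<And>i. i \<in> I \<Longrightarrow> quasitrivial_partition (\<Lambda> i); meets_boxes I S \<Lambda>\<rbrakk>
      \<Longrightarrow> contains_transversal I S \<Lambda>"
    and \<Lambda>: "\<And>i. i \<in> I \<Longrightarrow> \<Lambda> i \<noteq> {}" "\<And>i B. i \<in> I \<Longrightarrow> B \<in> \<Lambda> i \<Longrightarrow> B \<noteq> {} \<and> B \<subseteq> U i"
    and meets: "meets_boxes I S \<Lambda>"
  shows "contains_transversal I S \<Lambda>"
proof -
  \<comment> \<open>\<open>K\<close> collects the coordinates carrying arbitrary families. Induction
    on \<open>K\<close> keeps \<open>\<Lambda>\<close> general, since the induction hypothesis is
    used for \<open>\<Lambda>(k := \<beta>)\<close> with \<open>\<beta>\<close> quasi-trivial, where
    \<open>k\<close> has left the set of free coordinates.\<close>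
  have "contains_transversal I S \<Lambda>"
    if "K \<subseteq> I"
      "\<And>i. i \<in> I - K \<Longrightarrow> partition_on (U i) (\<Lambda> i) \<and> quasitrivial_partition (\<Lambda> i)"
      "\<And>i. i \<in> K \<Longrightarrow> \<Lambda> i \<noteq> {} \<and> (\<forall>B\<in>\<Lambda> i. B \<noteq> {} \<and> B \<subseteq> U i)"
      "meets_boxes I S \<Lambda>" for K \<Lambda>
    using finite_subset[OF \<open>K \<subseteq> I\<close> \<open>finite I\<close>] that
  proof (induction K arbitrary: \<Lambda> rule: finite_induct)
    case empty
    then show ?case
      by (intro quasi) auto
  next
    case (insert k K)
    show ?case
    proof (rule transversal_of_quasitrivial[where i = k and U = "U k"])
      fix \<beta> assume \<beta>: "partition_on (U k) \<beta>" "quasitrivial_partition \<beta>"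
        and meets: "meets_boxes I S (\<Lambda>(k := \<beta>))"
      show "contains_transversal I S (\<Lambda>(k := \<beta>))"
      proof (rule insert.IH[OF _ _ _ meets])
        show "partition_on (U i) ((\<Lambda>(k := \<beta>)) i) \<and> quasitrivial_partition ((\<Lambda>(k := \<beta>)) i)"
          if "i \<in> I - K" for i
          using \<beta> insert.prems(2)[of i] that by auto
      next
        show "(\<Lambda>(k := \<beta>)) i \<noteq> {} \<and> (\<forall>B\<in>(\<Lambda>(k := \<beta>)) i. B \<noteq> {} \<and> B \<subseteq> U i)"
          if "i \<in> K" for i
          using insert.prems(3)[of i] insert.hyps(2) that by auto
      qed (use insert.prems(1) in simp)
    qed (use insert.prems U in auto)
  qed
  from this[OF subset_refl _ _ meets] show ?thesis
    using \<Lambda> by simp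
qed

section \<open>Translation from minor-subproducts\<close>

lemma shattered_iff:
  "shattered m U S (A, V, \<Lambda>) \<longleftrightarrow>
    meets_boxes {1..m} S (\<lambda>i. if i \<in> A then \<Lambda> i else {U i})" (is "_ \<longleftrightarrow> meets_boxes ?I S ?\<Lambda>")
proof -
  have "(\<forall>P\<in>Pi\<^sub>E ?I ?\<Lambda>. S \<inter> Pi\<^sub>E ?I P \<noteq> {}) \<longleftrightarrow> (\<forall>P\<in>Pi ?I ?\<Lambda>. S \<inter> Pi\<^sub>E ?I P \<noteq> {})"
  proof (intro iffI ballI)
    fix P assume *: "\<forall>P\<in>Pi\<^sub>E ?I ?\<Lambda>. S \<inter> Pi\<^sub>E ?I P \<noteq> {}" and "P \<in> Pi ?I ?\<Lambda>"
    then have "restrict P ?I \<in> Pi\<^sub>E ?I ?\<Lambda>"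
      by (auto simp: Pi_iff)
    then have "S \<inter> Pi\<^sub>E ?I (restrict P ?I) \<noteq> {}"
      using * by blast
    moreover have "Pi\<^sub>E ?I (restrict P ?I) = Pi\<^sub>E ?I P"
      by (rule PiE_cong) auto
    ultimately show "S \<inter> Pi\<^sub>E ?I P \<noteq> {}"
      by simp
  qed (auto simp: PiE_def)
  then show ?thesis
    by (simp add: shattered_def meets_boxes_def minor_boxes_def full_minor_def minor_points_def)
qed

lemma copy_iff_contains_transversal:
  assumes part: "\<And>i. i \<in> I \<Longrightarrow> partition_on (V i) (\<Lambda> i)"
  shows "(\<exists>W. is_copy (I, V, \<Lambda>) W \<and> W \<subseteq> S) \<longleftrightarrow> contains_transversal I S \<Lambda>"
proof
  assume "\<exists>W. is_copy (I, V, \<Lambda>) W \<and> W \<subseteq> S"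
  then obtain w where w: "\<forall>i\<in>I. w i \<subseteq> V i \<and> (\<forall>B\<in>\<Lambda> i. \<exists>!x. x \<in> B \<and> x \<in> w i)"
    "Pi\<^sub>E I w \<subseteq> S"
    unfolding is_copy_def prod.case by metis
  then have "\<forall>i\<in>I. \<forall>B\<in>\<Lambda> i. w i \<inter> B \<noteq> {}"
    by blast
  then show "contains_transversal I S \<Lambda>"
    unfolding contains_transversal_def using w(2) by (intro exI[of _ w] conjI)
next
  assume "contains_transversal I S \<Lambda>"
  then obtain L where L: "\<forall>i\<in>I. \<forall>B\<in>\<Lambda> i. L i \<inter> B \<noteq> {}" "Pi\<^sub>E I L \<subseteq> S"
    unfolding contains_transversal_def by blast
  \<comment> \<open>\<open>c i B\<close> represents the block \<open>B\<close> inside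
    \<open>L i\<close>. Keeping only these representatives leaves one point per block, because
    distinct blocks are disjoint.\<close>
  define c where "c i B = (SOME x. x \<in> L i \<inter> B)" for i B
  have c: "c i B \<in> L i" "c i B \<in> B" if "i \<in> I" "B \<in> \<Lambda> i" for i B
    using L(1) that some_in_eq[of "L i \<inter> B"] by (auto simp: c_def)
  define w where "w i = c i ` \<Lambda> i" for i
  have "w i \<subseteq> V i" if "i \<in> I" for i
    using c[OF that] part[OF that] by (auto simp: w_def partition_on_def)
  moreover have "\<exists>!x. x \<in> B \<and> x \<in> w i" if "i \<in> I" "B \<in> \<Lambda> i" for i B
  proof (rule ex1I[of _ "c i B"])
    show "c i B \<in> B \<and> c i B \<in> w i"
      using c that by (auto simp: w_def)
    fix x assume "x \<in> B \<and> x \<in> w i"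
    then obtain C where "C \<in> \<Lambda> i" "x = c i C" "x \<in> B"
      by (auto simp: w_def)
    moreover have "disjoint (\<Lambda> i)"
      using part[OF \<open>i \<in> I\<close>] by (simp add: partition_on_def)
    ultimately have "C = B"
      using disjointD[of "\<Lambda> i" C B] c(2)[OF \<open>i \<in> I\<close>] \<open>B \<in> \<Lambda> i\<close> by blast
    then show "x = c i B"
      using \<open>x = c i C\<close> by simp
  qed
  moreover have "Pi\<^sub>E I w \<subseteq> S"
    using c by (intro order.trans[OF PiE_mono L(2)]) (auto simp: w_def)
  ultimately show "\<exists>W. is_copy (I, V, \<Lambda>) W \<and> W \<subseteq> S"
    unfolding is_copy_def prod.case by (intro exI[of _ "Pi\<^sub>E I w"] exI[of _ w] conjI ballI) simp_all
qed

lemma strongly_shattered_iff: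
  assumes "\<forall>i\<in>{1..m}. U i \<noteq> {}" "is_generalized_partition A V \<Lambda>"
  shows "strongly_shattered m U S (A, V, \<Lambda>) \<longleftrightarrow>
    contains_transversal {1..m} S (\<lambda>i. if i \<in> A then \<Lambda> i else {U i})"
proof -
  have "partition_on (U i) {U i}" if "i \<in> {1..m}" for i
    using assms(1) that by (auto simp: partition_on_def disjoint_def)
  then show ?thesis
    unfolding strongly_shattered_def full_minor_def prod.case
    using assms(2)
    by (intro copy_iff_contains_transversal) (auto simp: is_generalized_partition_def)
qed

lemma meets_boxes_cong:
  assumes "\<And>i. i \<in> I \<Longrightarrow> \<Lambda> i = \<Lambda>' i"
  shows "meets_boxes I S \<Lambda> \<longleftrightarrow> meets_boxes I S \<Lambda>'"
proof -
  have "Pi I \<Lambda> = Pi I \<Lambda>'"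
    using assms by (simp add: Pi_def)
  then show ?thesis
    unfolding meets_boxes_def by simp
qed

lemma contains_transversal_cong:
  "(\<And>i. i \<in> I \<Longrightarrow> \<Lambda> i = \<Lambda>' i) \<Longrightarrow> contains_transversal I S \<Lambda> \<longleftrightarrow> contains_transversal I S \<Lambda>'"
  by (simp add: contains_transversal_def)

lemma shattered_full_iff:
  "shattered m U S ({1..m}, V, \<Lambda>) \<longleftrightarrow> meets_boxes {1..m} S \<Lambda>"
  unfolding shattered_iff by (rule meets_boxes_cong) simp

lemma strongly_shattered_full_iff:
  assumes "\<forall>i\<in>{1..m}. U i \<noteq> {}" "is_generalized_partition {1..m} V \<Lambda>"
  shows "strongly_shattered m U S ({1..m}, V, \<Lambda>) \<longleftrightarrow> contains_transversal {1..m} S \<Lambda>"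
  unfolding strongly_shattered_iff[OF assms] by (rule contains_transversal_cong) simp

section \<open>Equivalence of the ampleness conditions\<close>

text \<open>This leads from the smallest of the four classes to the largest; the remaining
  implications are inclusions of classes. Proper supports and proper factors fit the exchange
  argument because their blocks are still nonempty subsets of the \<open>U i\<close>.\<close>

lemma ample_for_MProd2_if_MextProd:
  assumes U: "\<forall>i\<in>{1..m}. U i \<noteq> {}" and ext: "ample_for m U (MextProd m U) S"
  shows "ample_for m U (MProd2 m U) S"
  unfolding ample_for_def
proof (intro ballI impI)
  fix M assume M: "M \<in> MProd2 m U" and sh: "shattered m U S M"
  obtain A V \<Lambda> where M_eq: "M = (A, V, \<Lambda>)"
    by (cases M)
  let ?\<Lambda> = "\<lambda>i. if i \<in> A then \<Lambda> i else {U i}"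
  have gp: "is_generalized_partition A V \<Lambda>" and sub: "is_subproduct m U A V"
    using M by (auto simp: M_eq MProd2_def)
  have "contains_transversal {1..m} S ?\<Lambda>"
  proof (rule contains_transversal_if_quasitrivial[where U = U])
    show "meets_boxes {1..m} S ?\<Lambda>"
      using sh by (simp add: M_eq shattered_iff)
    fix i assume i: "i \<in> {1..m}"
    have part: "partition_on (V i) (\<Lambda> i)" "V i \<noteq> {}" "V i \<subseteq> U i" if "i \<in> A"
      using that gp sub by (auto simp: is_generalized_partition_def is_subproduct_def)
    then show "?\<Lambda> i \<noteq> {}"
      by (auto simp: partition_on_def)
    show "B \<noteq> {} \<and> B \<subseteq> U i" if "B \<in> ?\<Lambda> i" for B
      using part bspec[OF U i] that by (auto simp: partition_on_def split: if_splits)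
  next
    fix \<Lambda>' :: "nat \<Rightarrow> 'a set set"
    assume part: "\<And>i. i \<in> {1..m} \<Longrightarrow> partition_on (U i) (\<Lambda>' i)"
      and quasi: "\<And>i. i \<in> {1..m} \<Longrightarrow> quasitrivial_partition (\<Lambda>' i)"
      and meets: "meets_boxes {1..m} S \<Lambda>'"
    have gp': "is_generalized_partition {1..m} U \<Lambda>'"
      using part by (simp add: is_generalized_partition_def)
    then have "({1..m}, U, \<Lambda>') \<in> MextProd m U"
      using quasi by (auto simp: MextProd_def MProd_def)
    then show "contains_transversal {1..m} S \<Lambda>'"
      using ext meets strongly_shattered_full_iff[OF U gp', of S]
      unfolding ample_for_def shattered_full_iff[symmetric, where V = U and U = U] by blast
  qed (use U in auto)
  then show "strongly_shattered m U S M"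
    using strongly_shattered_iff[OF U gp] by (simp add: M_eq)
qed

section \<open>Lopsidedness and weak ampleness\<close>

text \<open>A copy of the complement has one point where \<open>M\<close> is trivial and all of
  \<open>U i\<close> elsewhere, so it is a box of \<open>M\<close>. It lies in the complement of
  \<open>S\<close> exactly when \<open>S\<close> misses that box.\<close>

lemma minor_complement_strongly_shattered_iff:
  assumes U: "\<forall>i\<in>{1..m}. U i \<noteq> {}" and M: "M \<in> MixedProd m U"
  shows "strongly_shattered m U (Pi\<^sub>E {1..m} U - S) (minor_complement M) \<longleftrightarrow>
    \<not> shattered m U S M"
proof -
  let ?I = "{1..m}"
  obtain \<Lambda> where M_eq: "M = (?I, U, \<Lambda>)" and part: "\<And>i. i \<in> ?I \<Longrightarrow> partition_on (U i) (\<Lambda> i)"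
    and mixed: "\<And>i. i \<in> ?I \<Longrightarrow> trivial_partition (\<Lambda> i) \<or> cotrivial_partition (\<Lambda> i)"
    using M by (auto simp: MixedProd_def MProd_def is_generalized_partition_def)
  have nontrivial: "\<Lambda> i = {U i}" if "i \<in> ?I" "\<not> trivial_partition (\<Lambda> i)" for i
    using mixed[OF that(1)] part[OF that(1)] that(2)
    by (auto simp: cotrivial_partition_def partition_on_def elim!: is_singletonE)
  define \<Lambda>c where "\<Lambda>c i = (if trivial_partition (\<Lambda> i) then {U i} else (\<lambda>x. {x}) ` U i)" for i
  have "is_generalized_partition ?I U \<Lambda>c"
    unfolding is_generalized_partition_def
  proof
    fix i assume "i \<in> ?I"
    then have "U i \<noteq> {}"
      using U by blast
    then show "partition_on (U i) (\<Lambda>c i)"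
      by (auto simp: \<Lambda>c_def partition_on_def disjoint_def)
  qed
  then have "strongly_shattered m U (Pi\<^sub>E ?I U - S) (minor_complement M) \<longleftrightarrow>
      contains_transversal ?I (Pi\<^sub>E ?I U - S) \<Lambda>c"
    using strongly_shattered_full_iff[OF U, where \<Lambda> = \<Lambda>c]
    by (simp add: M_eq minor_complement_def \<Lambda>c_def[abs_def])
  also have "\<dots> \<longleftrightarrow> \<not> meets_boxes ?I S \<Lambda>"
  proof
    assume "contains_transversal ?I (Pi\<^sub>E ?I U - S) \<Lambda>c"
    then obtain L where L: "\<forall>i\<in>?I. \<forall>B\<in>\<Lambda>c i. L i \<inter> B \<noteq> {}" "Pi\<^sub>E ?I L \<subseteq> Pi\<^sub>E ?I U - S"
      unfolding contains_transversal_def by blast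
    \<comment> \<open>The product of \<open>L\<close> contains a box of \<open>M\<close>. In a
      trivial coordinate \<open>L i\<close> contains a point of \<open>U i\<close>, whose singleton
      is a block; otherwise \<open>L i\<close> meets every singleton and so contains the only block
      \<open>U i\<close>.\<close>
    have "\<exists>B\<in>\<Lambda> i. B \<subseteq> L i" if i: "i \<in> ?I" for i
    proof (cases "trivial_partition (\<Lambda> i)")
      case True
      then obtain x where "x \<in> L i" "x \<in> U i"
        using L(1) i by (fastforce simp: \<Lambda>c_def)
      then obtain B where "B \<in> \<Lambda> i" "x \<in> B"
        using part[OF i] by (auto simp: partition_on_def)
      moreover have "B = {x}"
        using True calculation unfolding trivial_partition_def by (auto elim!: is_singletonE)
      ultimately show ?thesis
        using \<open>x \<in> L i\<close> by blast
    next
      case False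
      then have "\<forall>x\<in>U i. L i \<inter> {x} \<noteq> {}"
        using bspec[OF L(1) i] by (simp add: \<Lambda>c_def)
      then have "U i \<subseteq> L i"
        by blast
      then show ?thesis
        using nontrivial[OF i False] by simp
    qed
    then obtain P where P: "\<forall>i\<in>?I. P i \<in> \<Lambda> i \<and> P i \<subseteq> L i"
      by metis
    then have "Pi\<^sub>E ?I P \<subseteq> Pi\<^sub>E ?I L"
      by (intro PiE_mono) auto
    then have "S \<inter> Pi\<^sub>E ?I P = {}"
      using L(2) by blast
    then show "\<not> meets_boxes ?I S \<Lambda>"
      unfolding meets_boxes_def using P by (auto simp: Pi_iff intro!: bexI[of _ P])
  next
    assume "\<not> meets_boxes ?I S \<Lambda>"
    then obtain P where P: "P \<in> Pi ?I \<Lambda>" "S \<inter> Pi\<^sub>E ?I P = {}"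
      unfolding meets_boxes_def by blast
    have sub: "P i \<subseteq> U i" "P i \<noteq> {}" if "i \<in> ?I" for i
      using Pi_mem[OF P(1) that] part[OF that] by (auto simp: partition_on_def)
    \<comment> \<open>Conversely, the missed box \<open>P\<close> itself serves as the transversal
      for the complement.\<close>
    have "P i \<inter> B \<noteq> {}" if i: "i \<in> ?I" and B: "B \<in> \<Lambda>c i" for i B
    proof (cases "trivial_partition (\<Lambda> i)")
      case True
      then show ?thesis
        using sub[OF i] B by (auto simp: \<Lambda>c_def)
    next
      case False
      then show ?thesis
        using nontrivial[OF i] B Pi_mem[OF P(1) i] by (auto simp: \<Lambda>c_def)
    qed
    moreover have "Pi\<^sub>E ?I P \<subseteq> Pi\<^sub>E ?I U - S"
      using P(2) PiE_mono[of ?I P U] sub by blast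
    ultimately show "contains_transversal ?I (Pi\<^sub>E ?I U - S) \<Lambda>c"
      unfolding contains_transversal_def by (intro exI[of _ P] conjI) auto
  qed
  also have "\<dots> \<longleftrightarrow> \<not> shattered m U S M"
    unfolding M_eq shattered_full_iff by simp
  finally show ?thesis .
qed

lemma ample_for_antimono:
  "\<M> \<subseteq> \<N> \<Longrightarrow> ample_for m U \<N> S \<Longrightarrow> ample_for m U \<M> S"
  by (auto simp: ample_for_def)

theorem theorem1:
  fixes m :: nat and U :: "nat \<Rightarrow> 'a set" and S :: "(nat \<Rightarrow> 'a) set"
  assumes "\<And>i. i \<in> {1..m} \<Longrightarrow> finite (U i) \<and> U i \<noteq> {}"
    and "S \<subseteq> Pi\<^sub>E {1..m} U"
  shows "(ample m U S \<longleftrightarrow> ample_for m U (MProd1 m U) S) \<and>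
         (ample m U S \<longleftrightarrow> ample_for m U (MProd2 m U) S) \<and>
         (ample m U S \<longleftrightarrow> ample_for m U (MextProd m U) S) \<and>
         (lopsided m U S \<longleftrightarrow> weakly_ample m U S) \<and>
         (ample m U S \<longrightarrow> lopsided m U S)"
proof -
  have U: "\<forall>i\<in>{1..m}. U i \<noteq> {}"
    using assms(1) by blast
  have "MextProd m U \<subseteq> MProd m U" "MixedProd m U \<subseteq> MProd m U" "MProd1 m U \<subseteq> MProd2 m U"
    by (auto simp: MextProd_def MixedProd_def MProd1_def MProd2_def)
  moreover have "MProd m U \<subseteq> MProd1 m U"
    using U by (auto simp: MProd_def MProd1_def is_subproduct_def)
  \<comment> \<open>With its second alternative read as failure of shattering, lopsidedness is the
    implication that defines weak ampleness.\<close>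
  moreover have "lopsided m U S \<longleftrightarrow> weakly_ample m U S"
    using minor_complement_strongly_shattered_iff[OF U]
    unfolding lopsided_def weakly_ample_def ample_for_def by blast
  ultimately show ?thesis
    using ample_for_MProd2_if_MextProd[OF U, of S] ample_for_antimono[of _ _ m U S]
    unfolding ample_def weakly_ample_def by metis
qed

end
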